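(* Let $n\ge 1$ and $\lambda\in[1/(n+1),1/2]$. Let $x,y\in\mathbb{R}^n$ and let $\ell=[x,y]=\{(1-\mu)x+\mu y: 0\le\mu\le 1\}\subset\mathbb{R}^n$. Then for every $P\in \mathrm{VG}(\mathbb{R}^n,\lambda)$ one has $P+\ell\in \mathrm{VG}(\mathbb{R}^n,\lambda)$.
   Context: A polytope in $\mathbb{R}^n$ is the convex hull of a finite non-empty set of points (it need not have non-empty interior); $V(P)$ denotes the set of vertices of $P$; $A+B=\{a+b: a\in A,b\in B\}$ is the Minkowski sum. For a polytope $P\subset\mathbb{R}^n$ let $\lambda(P)=\sup\{\lambda\in\mathbb{R}: P=(1-\lambda)P+\lambda V(P)\}$ (value in $(-\infty,+\infty]$; it is $+\infty$ exactly when $P$ is a single point). $P$ is called $\lambda$-vertex generated if $\lambda(P)\ge\lambda$, and $\mathrm{VG}(\mathbb{R}^n,\lambda)$ is the class of $\lambda$-vertex generated polytopes in $\mathbb{R}^n$. *)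

theory Defs
  imports "HOL-Analysis.Analysis"
begin

text \<open>Sums of sets are Minkowski sums, as provided by \<open>HOL-Library.Set_Algebras\<close>.\<close>

definition vertices :: "'a::real_vector set \<Rightarrow> 'a set" where
  "vertices P = {v. v extreme_point_of P}"

text \<open>
  The number \<open>\<lambda>(P)\<close>. The supremum ranges over all real \<open>t\<close>; it is taken in \<^typ>\<open>ereal\<close>
  because the set of admissible \<open>t\<close> is unbounded when \<open>P\<close> is a single point.
\<close>
definition vg_number :: "'a::real_vector set \<Rightarrow> ereal" where
  "vg_number P =
     (SUP t \<in> {t::real. P = (\<lambda>p. (1 - t) *\<^sub>R p) ` P + (\<lambda>v. t *\<^sub>R v) ` vertices P}. ereal t)"

text \<open>Nonemptiness is required explicitly because \<^const>\<open>polytope\<close> admits the empty set.\<close>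
definition VG :: "real \<Rightarrow> (real ^ 'n) set set" where
  "VG c = {P. polytope P \<and> P \<noteq> {} \<and> ereal c \<le> vg_number P}"

end

theory Submission
  imports Defs
begin

text \<open>
  The admissible parameters \<open>t \<in> [0, 1]\<close> of a polytope \<open>P\<close> are those for which every point of \<open>P\<close>
  is \<open>(1 - t) q + t v\<close> with \<open>q \<in> P\<close> and a vertex \<open>v\<close>; they form an interval containing \<open>0\<close>.
  Let \<open>u = y - x\<close> and \<open>z = p + x + s u\<close>. A decomposition of \<open>p\<close> lifts to one of \<open>z\<close> with vertex
  \<open>v + x\<close> if \<open>s \<le> 1 - t\<close>, and with vertex \<open>v + y\<close> if \<open>s \<ge> t\<close>. At least one of \<open>v + x\<close>, \<open>v + y\<close>
  is a vertex of \<open>P + [x, y]\<close>, so every \<open>s \<in> [t, 1 - t]\<close> is fine. If \<open>s < t\<close>, slide \<open>p\<close> in the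
  direction \<open>-u\<close> while increasing \<open>s\<close>: either \<open>s\<close> reaches \<open>t\<close>, or \<open>p\<close> runs into a face of \<open>P\<close> on
  which a functional \<open>a\<close> with \<open>a \<bullet> x > a \<bullet> y\<close> is maximal. In the latter case \<open>v\<close> lies on the same
  face, so \<open>v + x\<close> is a vertex of the sum. The case \<open>s > 1 - t\<close> is symmetric.
\<close>

section \<open>Vertices of a Minkowski sum with a segment\<close>

text \<open>If \<open>a + b\<close> lies strictly between two points of the sum, these also maximize
  \<open>g\<close>; hence their \<open>B\<close>-parts equal \<open>b\<close>, and cancelling
  \<open>b\<close> leaves \<open>a\<close> strictly between two points of \<open>A\<close>.
  Uniqueness is asked of one summand, and either can play that role.\<close>

lemma extreme_point_of_set_plus:
  fixes A B :: "'a::euclidean_space set"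
  assumes "a extreme_point_of A" and "\<And>z. z \<in> A \<Longrightarrow> g \<bullet> z \<le> g \<bullet> a"
    and "b \<in> B" and "\<And>z. z \<in> B \<Longrightarrow> g \<bullet> z \<le> g \<bullet> b"
    and unique: "\<And>z. z \<in> B \<Longrightarrow> g \<bullet> z = g \<bullet> b \<Longrightarrow> z = b"
  shows "(a + b) extreme_point_of (A + B)"
  unfolding extreme_point_of_def
proof (intro conjI ballI notI)
  show "a + b \<in> A + B"
    using assms by (auto simp: extreme_point_of_def)
next
  fix w1 w2
  assume "w1 \<in> A + B" "w2 \<in> A + B" and seg: "a + b \<in> open_segment w1 w2"
  then obtain a1 b1 a2 b2 where w: "w1 = a1 + b1" "w2 = a2 + b2"
    and in_sets: "a1 \<in> A" "b1 \<in> B" "a2 \<in> A" "b2 \<in> B"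
    by (auto elim!: set_plus_elim)
  from seg obtain m where m: "0 < m" "m < 1" and ne: "w1 \<noteq> w2"
    and eq: "a + b = (1 - m) *\<^sub>R w1 + m *\<^sub>R w2"
    by (auto simp: in_segment)
  \<comment> \<open>Deficits below the maximum: both are nonnegative, and their mean with positive
    weights is zero.\<close>
  define d1 where "d1 = g \<bullet> (a + b) - g \<bullet> w1"
  define d2 where "d2 = g \<bullet> (a + b) - g \<bullet> w2"
  have le: "g \<bullet> a1 \<le> g \<bullet> a" "g \<bullet> a2 \<le> g \<bullet> a" "g \<bullet> b1 \<le> g \<bullet> b" "g \<bullet> b2 \<le> g \<bullet> b"
    using in_sets assms by auto
  then have "d1 \<ge> 0" "d2 \<ge> 0"
    by (auto simp: d1_def d2_def w inner_add_right)
  moreover have "(1 - m) * d1 + m * d2 = 0"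
    using arg_cong[OF eq, of "\<lambda>z. g \<bullet> z"]
    by (simp add: d1_def d2_def inner_add_right algebra_simps)
  ultimately have "d1 = 0" "d2 = 0"
    using m by (auto simp: add_nonneg_eq_0_iff)
  then have "g \<bullet> b1 = g \<bullet> b" "g \<bullet> b2 = g \<bullet> b"
    using le by (auto simp: d1_def d2_def w inner_add_right)
  then have b: "b1 = b" "b2 = b"
    using unique in_sets by auto
  have "a = (1 - m) *\<^sub>R a1 + m *\<^sub>R a2"
    using eq by (simp add: w b algebra_simps)
  moreover have "a1 \<noteq> a2"
    using ne by (simp add: w b)
  ultimately have "a \<in> open_segment a1 a2"
    using m by (auto simp: in_segment)
  then show False
    using assms(1) in_sets by (auto simp: extreme_point_of_def)
qed

lemma closed_segment_inner_le:
  fixes g :: "'a::euclidean_space"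
  assumes "g \<bullet> y \<le> g \<bullet> x" "z \<in> closed_segment x y"
  shows "g \<bullet> z \<le> g \<bullet> x"
proof -
  obtain m where m: "0 \<le> m" "m \<le> 1" "z = (1 - m) *\<^sub>R x + m *\<^sub>R y"
    using assms(2) by (auto simp: in_segment)
  have "m * (g \<bullet> y) \<le> m * (g \<bullet> x)"
    using m assms(1) by (intro mult_left_mono)
  then show ?thesis
    by (simp add: m inner_add_right algebra_simps)
qed

lemma closed_segment_inner_max_unique:
  fixes g :: "'a::euclidean_space"
  assumes "g \<bullet> y < g \<bullet> x" "z \<in> closed_segment x y" "g \<bullet> z = g \<bullet> x"
  shows "z = x"
proof -
  obtain m where m: "0 \<le> m" "m \<le> 1" "z = (1 - m) *\<^sub>R x + m *\<^sub>R y"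
    using assms(2) by (auto simp: in_segment)
  have "m * (g \<bullet> x - g \<bullet> y) = g \<bullet> x - g \<bullet> z"
    by (simp add: m inner_add_right algebra_simps)
  then have "m * (g \<bullet> x - g \<bullet> y) = 0"
    using assms(3) by linarith
  then have "m = 0"
    using assms(1) unfolding mult_eq_0_iff by linarith
  then show ?thesis
    by (simp add: m)
qed

lemma extreme_point_of_plus_segment_strict:
  fixes P :: "'a::euclidean_space set"
  assumes "v extreme_point_of P" "\<And>z. z \<in> P \<Longrightarrow> g \<bullet> z \<le> g \<bullet> v" "g \<bullet> y < g \<bullet> x"
  shows "(v + x) extreme_point_of (P + closed_segment x y)"
proof (rule extreme_point_of_set_plus[where g = g])
  show "g \<bullet> z \<le> g \<bullet> x" if "z \<in> closed_segment x y" for z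
    using assms(3) closed_segment_inner_le that by (meson less_imp_le)
  show "z = x" if "z \<in> closed_segment x y" "g \<bullet> z = g \<bullet> x" for z
    using closed_segment_inner_max_unique assms(3) that by blast
qed (use assms(1,2) in simp_all)

text \<open>A vertex of a polyhedron is exposed by some \<open>g\<close>, and one endpoint of the
  segment maximizes \<open>g\<close> on it.\<close>

lemma extreme_point_of_plus_segment_or:
  fixes P :: "'a::euclidean_space set"
  assumes "polyhedron P" "v extreme_point_of P"
  shows "(v + x) extreme_point_of (P + closed_segment x y) \<or>
         (v + y) extreme_point_of (P + closed_segment x y)"
proof -
  have "{v} exposed_face_of P"
    using assms by (simp add: exposed_face_of_polyhedron face_of_singleton)
  then obtain g b where g: "P \<subseteq> {z. g \<bullet> z \<le> b}" "{v} = P \<inter> {z. g \<bullet> z = b}"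
    by (auto simp: exposed_face_of_def)
  have mem: "z = v \<longleftrightarrow> z \<in> P \<and> g \<bullet> z = b" for z
    using eqset_imp_iff[OF g(2), of z] by simp
  from mem[of v] have "v \<in> P" and b: "b = g \<bullet> v"
    by simp_all
  have vertex: "(v + e) extreme_point_of (P + closed_segment e f)" if "g \<bullet> f \<le> g \<bullet> e" for e f
  proof -
    \<comment> \<open>The summands are swapped: the maximizer is unique on \<open>P\<close>, while
      \<open>g\<close> may be constant on the segment.\<close>
    have "(e + v) extreme_point_of (closed_segment e f + P)"
    proof (rule extreme_point_of_set_plus[where g = g])
      show "g \<bullet> z \<le> g \<bullet> v" if "z \<in> P" for z
        using g(1) that unfolding b by blast
      show "z = v" if "z \<in> P" "g \<bullet> z = g \<bullet> v" for z
        using mem[of z] that unfolding b by blast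
    qed (use \<open>v \<in> P\<close> closed_segment_inner_le[OF that] in
        \<open>simp_all add: extreme_point_of_segment\<close>)
    then show ?thesis
      by (simp add: add.commute)
  qed
  show ?thesis
    using vertex[of x y] vertex[of y x] linear[of "g \<bullet> x" "g \<bullet> y"]
    unfolding closed_segment_commute[of y x] by blast
qed

section \<open>Exit of a ray from a polyhedron\<close>

text \<open>The ray leaves at the smallest parameter where a halfspace with normal positive on
  \<open>w\<close> becomes tight; that normal serves as \<open>g\<close>.\<close>

lemma polyhedron_ray_exit:
  fixes P :: "'a::euclidean_space set"
  assumes "polyhedron P" "p \<in> P" "0 \<le> d" "p + d *\<^sub>R w \<notin> P"
  obtains r g where "0 \<le> r" "r < d" "p + r *\<^sub>R w \<in> P" "0 < g \<bullet> w"
    "\<And>z. z \<in> P \<Longrightarrow> g \<bullet> z \<le> g \<bullet> (p + r *\<^sub>R w)"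
proof -
  obtain F where F: "finite F" "P = \<Inter>F" "\<forall>h\<in>F. \<exists>a b. a \<noteq> 0 \<and> h = {z. a \<bullet> z \<le> b}"
    using assms(1) by (auto simp: polyhedron_def)
  then obtain a b where ab: "\<And>h. h \<in> F \<Longrightarrow> h = {z. a h \<bullet> z \<le> b h}"
    by metis
  have P_iff: "z \<in> P \<longleftrightarrow> (\<forall>h\<in>F. a h \<bullet> z \<le> b h)" for z
    using F(2) ab by blast
  define G where "G = {h \<in> F. 0 < a h \<bullet> w}"
  define \<rho> where "\<rho> h = (b h - a h \<bullet> p) / (a h \<bullet> w)" for h
  define r where "r = Min (\<rho> ` G)"
  \<comment> \<open>A constraint violated at \<open>d\<close> shows that \<open>G\<close> is
    nonempty and that \<open>r < d\<close>.\<close>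
  obtain k where k: "k \<in> F" "b k < a k \<bullet> (p + d *\<^sub>R w)"
    using assms(4) by (auto simp: P_iff not_le)
  have p: "a h \<bullet> p \<le> b h" if "h \<in> F" for h
    using assms(2) that by (simp add: P_iff)
  have "0 < d * (a k \<bullet> w)"
    using k p[of k] by (simp add: inner_add_right)
  then have kw: "0 < a k \<bullet> w"
    using assms(3) by (simp add: zero_less_mult_iff)
  then have "k \<in> G"
    using k by (simp add: G_def)
  have finG: "finite (\<rho> ` G)"
    using F(1) by (simp add: G_def)
  have "r \<le> \<rho> k"
    unfolding r_def using finG \<open>k \<in> G\<close> by simp
  moreover have "\<rho> k < d"
    using k kw by (simp add: \<rho>_def divide_simps inner_add_right)
  ultimately have "r < d"
    by simp
  have "r \<in> \<rho> ` G"
    unfolding r_def using finG \<open>k \<in> G\<close> by (intro Min_in) auto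
  then obtain h where h: "h \<in> G" "r = \<rho> h"
    by auto
  have "0 \<le> r"
    using h p by (simp add: \<rho>_def G_def)
  have tight: "a h \<bullet> (p + r *\<^sub>R w) = b h"
    using h by (simp add: \<rho>_def G_def inner_add_right)
  have "p + r *\<^sub>R w \<in> P"
    unfolding P_iff
  proof
    fix j assume j: "j \<in> F"
    show "a j \<bullet> (p + r *\<^sub>R w) \<le> b j"
    proof (cases "0 < a j \<bullet> w")
      case True
      then have "r \<le> \<rho> j"
        unfolding r_def using finG j by (simp add: G_def)
      then show ?thesis
        using True by (simp add: \<rho>_def inner_add_right field_simps)
    next
      case False
      then have "r * (a j \<bullet> w) \<le> 0"
        using \<open>0 \<le> r\<close> by (simp add: mult_nonneg_nonpos)
      then show ?thesis
        using p[OF j] by (simp add: inner_add_right)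
    qed
  qed
  with that[of r "a h"] show thesis
    using \<open>0 \<le> r\<close> \<open>r < d\<close> h tight by (simp add: G_def P_iff)
qed

section \<open>Lifting decompositions to the sum\<close>

definition vertex_decomposable :: "real \<Rightarrow> 'a::real_vector set \<Rightarrow> 'a \<Rightarrow> bool" where
  "vertex_decomposable t P z \<longleftrightarrow>
     (\<exists>q\<in>P. \<exists>v. v extreme_point_of P \<and> z = (1 - t) *\<^sub>R q + t *\<^sub>R v)"

lemma vertex_decomposable_plus_segment:
  fixes P :: "'a::euclidean_space set"
  assumes t: "0 \<le> t" "t < 1" and "q \<in> P" and p: "p = (1 - t) *\<^sub>R q + t *\<^sub>R v"
    and s: "0 \<le> s" "s \<le> 1 - t"
    and vertex: "(v + x) extreme_point_of (P + closed_segment x y)"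
  shows "vertex_decomposable t (P + closed_segment x y) (p + (1 - s) *\<^sub>R x + s *\<^sub>R y)"
proof -
  \<comment> \<open>The vertex \<open>v\<close> is paired with \<open>x\<close> alone, so
    \<open>q\<close> must carry the whole share \<open>s\<close> of \<open>y\<close>;
    \<open>s <= 1 - t\<close> makes \<open>m <= 1\<close>.\<close>
  define m where "m = s / (1 - t)"
  have m: "0 \<le> m" "m \<le> 1" and m_eq: "(1 - t) * m = s"
    using s t by (auto simp: m_def)
  have "q + ((1 - m) *\<^sub>R x + m *\<^sub>R y) \<in> P + closed_segment x y"
    using m \<open>q \<in> P\<close> by (intro set_plus_intro) (auto simp: in_segment)
  moreover have "p + (1 - s) *\<^sub>R x + s *\<^sub>R y
      = (1 - t) *\<^sub>R (q + ((1 - m) *\<^sub>R x + m *\<^sub>R y)) + t *\<^sub>R (v + x)"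
    unfolding p m_eq[symmetric] by (simp add: algebra_simps)
  ultimately show ?thesis
    using vertex unfolding vertex_decomposable_def by blast
qed

lemma vertex_decomposable_plus_segment_middle:
  fixes P :: "'a::euclidean_space set"
  assumes t: "0 \<le> t" "t < 1" and "polyhedron P" "vertex_decomposable t P p"
    and s: "t \<le> s" "s \<le> 1 - t"
  shows "vertex_decomposable t (P + closed_segment x y) (p + (1 - s) *\<^sub>R x + s *\<^sub>R y)"
proof -
  obtain q v where qv: "q \<in> P" "v extreme_point_of P" "p = (1 - t) *\<^sub>R q + t *\<^sub>R v"
    using assms by (auto simp: vertex_decomposable_def)
  from extreme_point_of_plus_segment_or[OF \<open>polyhedron P\<close> qv(2), of x y]
  show ?thesis
  proof
    assume "(v + x) extreme_point_of (P + closed_segment x y)"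
    then show ?thesis
      using t s by (intro vertex_decomposable_plus_segment[OF _ _ qv(1,3)]) auto
  next
    assume "(v + y) extreme_point_of (P + closed_segment x y)"
    \<comment> \<open>The same lifting with the endpoints exchanged and \<open>1 - s\<close> for
      \<open>s\<close>, which asks for \<open>t <= s\<close>.\<close>
    then have "vertex_decomposable t (P + closed_segment y x)
        (p + (1 - (1 - s)) *\<^sub>R y + (1 - s) *\<^sub>R x)"
      using t s by (intro vertex_decomposable_plus_segment[OF _ _ qv(1,3)])
        (auto simp: closed_segment_commute)
    then show ?thesis
      by (simp add: closed_segment_commute add_ac)
  qed
qed

lemma vertex_decomposable_plus_segment_low:
  fixes P :: "'a::euclidean_space set"
  assumes t: "0 < t" "t \<le> 1/2" and "polyhedron P"
    and dec: "\<And>p. p \<in> P \<Longrightarrow> vertex_decomposable t P p"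
    and s: "0 \<le> s" "s \<le> t" and "p \<in> P"
  shows "vertex_decomposable t (P + closed_segment x y) (p + (1 - s) *\<^sub>R x + s *\<^sub>R y)"
proof -
  \<comment> \<open>The point of the sum stays fixed when \<open>p\<close> moves by \<open>r\<close>
    times \<open>x - y\<close> and \<open>s\<close> grows by \<open>r\<close>.\<close>
  have shift: "p + (1 - s) *\<^sub>R x + s *\<^sub>R y
      = (p + r *\<^sub>R (x - y)) + (1 - (s + r)) *\<^sub>R x + (s + r) *\<^sub>R y" for r
    by (simp add: algebra_simps)
  show ?thesis
  proof (cases "p + (t - s) *\<^sub>R (x - y) \<in> P")
    case True
    \<comment> \<open>The shifted parameter equals \<open>t\<close>, which lies in the middle range
      as \<open>t <= 1/2\<close>.\<close>
    then show ?thesis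
      unfolding shift[of "t - s"]
      using t \<open>polyhedron P\<close> dec by (intro vertex_decomposable_plus_segment_middle) auto
  next
    case False
    then obtain r g where r: "0 \<le> r" "r < t - s" and in_P: "p + r *\<^sub>R (x - y) \<in> P"
      and g: "0 < g \<bullet> (x - y)" "\<And>z. z \<in> P \<Longrightarrow> g \<bullet> z \<le> g \<bullet> (p + r *\<^sub>R (x - y))"
      using polyhedron_ray_exit[OF \<open>polyhedron P\<close> \<open>p \<in> P\<close>, of "t - s" "x - y"] s by auto
    define p' where "p' = p + r *\<^sub>R (x - y)"
    obtain q v where qv: "q \<in> P" "v extreme_point_of P" "p' = (1 - t) *\<^sub>R q + t *\<^sub>R v"
      using dec[OF in_P] by (auto simp: vertex_decomposable_def p'_def)
    \<comment> \<open>A maximum of \<open>g\<close> at an average with positive weight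
      \<open>t\<close> on \<open>v\<close> forces \<open>v\<close> to be maximal too.\<close>
    have "(1 - t) * (g \<bullet> q) \<le> (1 - t) * (g \<bullet> p')"
      using g(2)[OF qv(1)] t by (intro mult_left_mono) (auto simp: p'_def)
    moreover have "g \<bullet> p' = (1 - t) * (g \<bullet> q) + t * (g \<bullet> v)"
      by (simp add: qv(3) inner_add_right)
    moreover have "(1 - t) * (g \<bullet> p') = g \<bullet> p' - t * (g \<bullet> p')"
      by (simp add: algebra_simps)
    ultimately have "t * (g \<bullet> p') \<le> t * (g \<bullet> v)"
      by linarith
    then have "g \<bullet> p' \<le> g \<bullet> v"
      using t by simp
    then have "g \<bullet> z \<le> g \<bullet> v" if "z \<in> P" for z
      using g(2)[OF that] by (simp add: p'_def)
    moreover have "g \<bullet> y < g \<bullet> x"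
      using g(1) by (simp add: inner_diff_right)
    ultimately have "(v + x) extreme_point_of (P + closed_segment x y)"
      by (rule extreme_point_of_plus_segment_strict[OF qv(2)])
    \<comment> \<open>Here \<open>s + r < t <= 1 - t\<close>, so the lifting applies with the vertex
      \<open>v + x\<close>.\<close>
    then show ?thesis
      unfolding shift[of r] p'_def[symmetric]
      using t s r by (intro vertex_decomposable_plus_segment[OF _ _ qv(1,3)]) auto
  qed
qed

lemma vertex_decomposable_plus_segment_all:
  fixes P :: "'a::euclidean_space set"
  assumes t: "0 < t" "t \<le> 1/2" and "polyhedron P"
    and dec: "\<And>p. p \<in> P \<Longrightarrow> vertex_decomposable t P p"
    and "z \<in> P + closed_segment x y"
  shows "vertex_decomposable t (P + closed_segment x y) z"
proof -
  obtain p s where "p \<in> P" and s: "0 \<le> s" "s \<le> 1"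
    and z: "z = p + (1 - s) *\<^sub>R x + s *\<^sub>R y"
    using assms(5) by (auto elim!: set_plus_elim simp: in_segment add.assoc)
  consider "s \<le> t" | "t \<le> s" "s \<le> 1 - t" | "1 - t \<le> s"
    by linarith
  then show ?thesis
  proof cases
    case 1
    then show ?thesis
      unfolding z using assms s \<open>p \<in> P\<close> by (intro vertex_decomposable_plus_segment_low) auto
  next
    case 2
    then show ?thesis
      unfolding z using assms \<open>p \<in> P\<close>
      by (intro vertex_decomposable_plus_segment_middle) auto
  next
    case 3
    then have "vertex_decomposable t (P + closed_segment y x)
        (p + (1 - (1 - s)) *\<^sub>R y + (1 - s) *\<^sub>R x)"
      using assms s \<open>p \<in> P\<close> by (intro vertex_decomposable_plus_segment_low) auto
    then show ?thesis
      unfolding z by (simp add: closed_segment_commute add_ac)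
  qed
qed

section \<open>Decompositions and the supremum\<close>

text \<open>The surplus weight \<open>t - s\<close> of \<open>v\<close> is moved into the point
  \<open>q\<close>, which stays in \<open>P\<close> by convexity.\<close>

lemma vertex_decomposable_mono:
  assumes "convex P" "vertex_decomposable t P p" "0 \<le> s" "s \<le> t" "t \<le> 1" "s < 1"
  shows "vertex_decomposable s P p"
proof -
  obtain q v where q: "q \<in> P" and v: "v extreme_point_of P"
    and p: "p = (1 - t) *\<^sub>R q + t *\<^sub>R v"
    using assms by (auto simp: vertex_decomposable_def)
  define m where "m = (t - s) / (1 - s)"
  have m: "0 \<le> m" "m \<le> 1" "(1 - s) * m = t - s"
    using assms by (auto simp: m_def)
  have "(1 - m) *\<^sub>R q + m *\<^sub>R v \<in> P"
    using assms(1) q v m by (auto simp: convex_alt extreme_point_of_def)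
  moreover have "p = (1 - s) *\<^sub>R ((1 - m) *\<^sub>R q + m *\<^sub>R v) + s *\<^sub>R v"
  proof -
    have "(1 - s) *\<^sub>R ((1 - m) *\<^sub>R q + m *\<^sub>R v) + s *\<^sub>R v
        = ((1 - s) - (1 - s) * m) *\<^sub>R q + ((1 - s) * m + s) *\<^sub>R v"
      by (simp add: algebra_simps)
    then show ?thesis
      by (simp add: p m(3))
  qed
  ultimately show ?thesis
    using v unfolding vertex_decomposable_def by blast
qed

text \<open>For \<open>t > 1\<close> the vertex \<open>v\<close> would be a proper convex combination of \<open>p\<close> and \<open>q\<close>.\<close>

lemma vertex_decomposable_gt_1:
  assumes "vertex_decomposable t P p" "1 < t" "p \<in> P"
  shows "vertex_decomposable s P p"
proof -
  obtain q v where q: "q \<in> P" and v: "v extreme_point_of P"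
    and p: "p = (1 - t) *\<^sub>R q + t *\<^sub>R v"
    using assms by (auto simp: vertex_decomposable_def)
  define m where "m = 1 / t"
  have m: "0 < m" "m < 1" "m * t = 1"
    using assms(2) by (auto simp: m_def)
  have "(1 - m) *\<^sub>R q + m *\<^sub>R p = (1 - m + m * (1 - t)) *\<^sub>R q + (m * t) *\<^sub>R v"
    by (simp add: p algebra_simps)
  also have "1 - m + m * (1 - t) = 0"
    using m(3) by (simp add: algebra_simps)
  finally have v_eq: "v = (1 - m) *\<^sub>R q + m *\<^sub>R p"
    using m(3) by simp
  have "q = p"
  proof (rule ccontr)
    assume "q \<noteq> p"
    then have "v \<in> open_segment q p"
      using m v_eq by (auto simp: in_segment)
    then show False
      using v q assms(3) by (auto simp: extreme_point_of_def)
  qed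
  then have "v = p"
    using v_eq by (simp add: algebra_simps)
  \<comment> \<open>Now \<open>p\<close> is itself a vertex and decomposes trivially for every
    \<open>s\<close>.\<close>
  then have "p = (1 - s) *\<^sub>R p + s *\<^sub>R v"
    by (simp add: algebra_simps)
  then show ?thesis
    using v assms(3) unfolding vertex_decomposable_def by blast
qed

lemma mem_scaled_plus_vertices_iff:
  "z \<in> (\<lambda>p. (1 - t) *\<^sub>R p) ` P + (\<lambda>v. t *\<^sub>R v) ` vertices P \<longleftrightarrow> vertex_decomposable t P z"
  by (auto simp: vertex_decomposable_def vertices_def set_plus_def)

text \<open>The supremum yields some admissible \<open>t' > t\<close>, which is lowered to
  \<open>t\<close> if \<open>t' <= 1\<close>; otherwise \<open>p\<close> is itself a vertex.\<close>

lemma vertex_decomposable_below_vg_number: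
  assumes "convex P" "ereal t < vg_number P" "0 \<le> t" "t < 1" "p \<in> P"
  shows "vertex_decomposable t P p"
proof -
  obtain t' where t': "t < t'"
    and P: "P = (\<lambda>p. (1 - t') *\<^sub>R p) ` P + (\<lambda>v. t' *\<^sub>R v) ` vertices P"
    using assms(2) by (auto simp: vg_number_def less_SUP_iff)
  have "vertex_decomposable t' P p"
    using assms(5) eqset_imp_iff[OF P, of p] unfolding mem_scaled_plus_vertices_iff by blast
  then show ?thesis
    using assms t' vertex_decomposable_mono[of P t' p t] vertex_decomposable_gt_1[of t' P p t]
    by (cases "t' \<le> 1") auto
qed

text \<open>Decomposability gives one inclusion, convexity the other.\<close>

lemma vg_number_ge:
  assumes "convex P" "0 \<le> t" "t \<le> 1" "\<And>p. p \<in> P \<Longrightarrow> vertex_decomposable t P p"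
  shows "ereal t \<le> vg_number P"
proof -
  have "p \<in> P" if "vertex_decomposable t P p" for p
    using that assms(1-3) by (auto simp: vertex_decomposable_def extreme_point_of_def convex_alt)
  then have "P = (\<lambda>p. (1 - t) *\<^sub>R p) ` P + (\<lambda>v. t *\<^sub>R v) ` vertices P"
    using assms(4) by (auto simp: mem_scaled_plus_vertices_iff)
  then show ?thesis
    unfolding vg_number_def by (intro SUP_upper) simp
qed

theorem theorem1p2:
  fixes c :: real and x y :: "real ^ 'n" and P :: "(real ^ 'n) set"
  assumes "1 / (real CARD('n) + 1) \<le> c" and "c \<le> 1 / 2"
    and "P \<in> VG c"
  shows "P + closed_segment x y \<in> VG c"
proof -
  have P: "polytope P" "P \<noteq> {}" "ereal c \<le> vg_number P"
    using assms(3) by (auto simp: VG_def)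
  have Q: "polytope (P + closed_segment x y)"
  proof -
    obtain V where "finite V" "P = convex hull V"
      using P(1) by (auto simp: polytope_def)
    then have "P + closed_segment x y = convex hull (V + {x, y})"
      by (simp only: segment_convex_hull convex_hull_set_plus)
    then show ?thesis
      using \<open>finite V\<close> by (simp add: polytope_convex_hull finite_set_plus)
  qed
  have "0 < c"
    using assms(1) by (rule less_le_trans[rotated]) simp
  \<comment> \<open>Since \<open>c\<close> is bounded only by a supremum, admissibility for
    \<open>P\<close> is derived strictly below \<open>c\<close>.\<close>
  have step: "ereal t \<le> vg_number (P + closed_segment x y)" if "0 < t" "t < c" for t
  proof -
    have t: "t \<le> 1/2" "0 \<le> t" "t < 1" "t \<le> 1"
      using that assms(2) by linarith+
    have "ereal t < ereal c"
      using \<open>t < c\<close> by simp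
    then have "ereal t < vg_number P"
      using P(3) by (rule less_le_trans)
    then have "vertex_decomposable t P p" if "p \<in> P" for p
      using vertex_decomposable_below_vg_number[OF polytope_imp_convex[OF P(1)]] t that by blast
    then have "vertex_decomposable t (P + closed_segment x y) z"
      if "z \<in> P + closed_segment x y" for z
      using vertex_decomposable_plus_segment_all[OF \<open>0 < t\<close> t(1) polytope_imp_polyhedron[OF P(1)]]
        that by blast
    then show ?thesis
      using vg_number_ge[OF polytope_imp_convex[OF Q] t(2,4)] by blast
  qed
  have "ereal c \<le> vg_number (P + closed_segment x y)"
  proof (rule ccontr)
    assume "\<not> ?thesis"
    \<comment> \<open>The maximum with \<open>0\<close> makes the intermediate \<open>t\<close>
      positive, as \<open>step\<close> requires.\<close>
    then have "max 0 (vg_number (P + closed_segment x y)) < ereal c"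
      using \<open>0 < c\<close> by simp
    then obtain t where "max 0 (vg_number (P + closed_segment x y)) < ereal t" "ereal t < ereal c"
      using ereal_dense2 by blast
    then show False
      using step[of t] by auto
  qed
  moreover have "P + closed_segment x y \<noteq> {}"
    using P(2) by (auto simp: set_plus_def)
  ultimately show ?thesis
    using Q by (simp add: VG_def)
qed

end
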